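(* Let $S=A+B$ with $A=QQ^*\in\mathbb{C}^{n\times n}$ Hermitian positive definite, $Q\in\mathbb{C}^{n\times n}$, and $B\in\mathbb{C}^{n\times n}$ Hermitian positive semidefinite, let $G=Q^{-1}BQ^{-*}$, let $r<\operatorname{rank}(B)$ be a positive integer, let $G_r$ be a rank-$r$ truncated SVD of $G$, and let $\widehat S_r=Q(I+G_r)Q^*$. Then $\widehat S_r$ is a minimiser of the problem $$\begin{aligned}\text{minimise over } X\in\mathbb{H}^n_+\quad & \mathcal{D}_{\mathrm{LD}}(\mathcal{P},S)\\ \text{subject to}\quad & \mathcal{P}=Q(I+X)Q^*,\\ &\operatorname{rank}(X)\le r,\end{aligned}$$ (that is, the minimum is attained at $X=G_r$, for which $\mathcal P=\widehat S_r$). Furthermore, the first $\operatorname{rank}(B)-r$ eigenvalues of $\widehat S_r^{-1}S$ are given by $1+\lambda_{r+i}(G)$, $i=1,\ldots,\operatorname{rank}(B)-r$, and the remaining ones are given by $1$ with multiplicity $n+r-\operatorname{rank}(B)$.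
   Context: $\mathbb{H}^n_+$ denotes the cone of Hermitian positive semidefinite $n\times n$ matrices and $\mathbb{H}^n_{++}$ the Hermitian positive definite ones. $\lambda_1(M)\ge\cdots\ge\lambda_n(M)$ denote the ordered eigenvalues of $M$ (when real). $M^*$ is the conjugate transpose, $M^{-*}=(M^{-1})^*$. A rank-$r$ truncated SVD of a Hermitian positive semidefinite $M=\sum_{i}\lambda_i(M)v_iv_i^*$ ($v_i$ orthonormal eigenvectors, eigenvalues in nonincreasing order) is $M_r=\sum_{i=1}^r\lambda_i(M)v_iv_i^*$. The Bregman log determinant divergence is, for $X,Y\in\mathbb{H}^n_{++}$, $$\mathcal{D}_{\mathrm{LD}}(X,Y)=\operatorname{trace}(XY^{-1})-\log\det(XY^{-1})-n.$$ *)

theory Defs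
  imports
    Complex_Main
    "Jordan_Normal_Form.Schur_Decomposition"
    "Jordan_Normal_Form.Gauss_Jordan_Elimination"
    "Jordan_Normal_Form.DL_Rank"
begin

text \<open>The order on complex numbers used below is the one of \<open>Complex_Order\<close>: \<open>0 \<le> z\<close> means that
  \<open>z\<close> is real and nonnegative. Note \<open>(M *\<^sub>v v) \<bullet>c v\<close> is \<open>v\<^sup>* M v\<close>.\<close>

definition hpsd :: "nat \<Rightarrow> complex mat \<Rightarrow> bool" where
  "hpsd n M \<longleftrightarrow> M \<in> carrier_mat n n \<and> mat_adjoint M = M
     \<and> (\<forall>v \<in> carrier_vec n. 0 \<le> (M *\<^sub>v v) \<bullet>c v)"

definition hpd :: "nat \<Rightarrow> complex mat \<Rightarrow> bool" where
  "hpd n M \<longleftrightarrow> M \<in> carrier_mat n n \<and> mat_adjoint M = M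
     \<and> (\<forall>v \<in> carrier_vec n. v \<noteq> 0\<^sub>v n \<longrightarrow> 0 < (M *\<^sub>v v) \<bullet>c v)"

text \<open>Unspecified for singular matrices.\<close>

definition mat_inv :: "complex mat \<Rightarrow> complex mat" where
  "mat_inv M = the (mat_inverse M)"

definition mat_trace :: "complex mat \<Rightarrow> complex" where
  "mat_trace M = (\<Sum>i<dim_row M. M $$ (i, i))"

text \<open>Eigenvalues repeated according to algebraic multiplicity, in nonincreasing order. Taking real
  parts makes this meaningful only for matrices all of whose eigenvalues are real.\<close>

definition ordered_eigvals :: "complex mat \<Rightarrow> real list" where
  "ordered_eigvals M = rev (sorted_list_of_multiset (image_mset Re (proots (char_poly M))))"

text \<open>Indices start at 1: \<open>eigval 1 M\<close> is the largest eigenvalue.\<close>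

definition eigval :: "nat \<Rightarrow> complex mat \<Rightarrow> real" where
  "eigval i M = ordered_eigvals M ! (i - 1)"

text \<open>The sum of \<open>\<lambda>\<^sub>i(M) v\<^sub>i v\<^sub>i\<^sup>*\<close> over \<open>i = 1, \<dots>, k\<close>, written entrywise.\<close>

definition spectral_sum :: "complex mat \<Rightarrow> (nat \<Rightarrow> complex vec) \<Rightarrow> nat \<Rightarrow> complex mat" where
  "spectral_sum M v k = mat (dim_row M) (dim_row M)
     (\<lambda>(a, b). \<Sum>i = 1..k. complex_of_real (eigval i M) * v i $ a * cnj (v i $ b))"

text \<open>A relation rather than a function, since the truncation depends on the choice of the
  eigenvectors when \<open>\<lambda>\<^sub>r(M) = \<lambda>\<^sub>r\<^sub>+\<^sub>1(M)\<close>.\<close>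

definition is_truncated_svd :: "nat \<Rightarrow> nat \<Rightarrow> complex mat \<Rightarrow> complex mat \<Rightarrow> bool" where
  "is_truncated_svd n r M Mr \<longleftrightarrow>
     (\<exists>v :: nat \<Rightarrow> complex vec.
        (\<forall>i \<in> {1..n}. eigenvector M (v i) (complex_of_real (eigval i M)))
        \<and> (\<forall>i \<in> {1..n}. \<forall>j \<in> {1..n}. v i \<bullet>c v j = (if i = j then 1 else 0))
        \<and> M = spectral_sum M v n
        \<and> Mr = spectral_sum M v r)"

text \<open>For positive definite \<open>X\<close> and \<open>Y\<close> of the same size, the trace and the determinant of
  \<open>X Y\<^sup>-\<^sup>1\<close> are real (and the determinant is positive),
  so taking real parts loses nothing.\<close>

definition logdet_div :: "complex mat \<Rightarrow> complex mat \<Rightarrow> real" where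
  "logdet_div X Y = Re (mat_trace (X * mat_inv Y)) - ln (Re (det (X * mat_inv Y)))
     - real (dim_row X)"

end

theory Submission
  imports Defs
begin

text \<open>
  Both \<open>S\<close> and every feasible \<open>P\<close> are congruent, by the same factor \<open>Q\<close>, to matrices of the form
  identity plus positive semidefinite: \<open>S = Q (I + G) Q\<^sup>*\<close> and \<open>P = Q (I + X) Q\<^sup>*\<close>. The factor \<open>Q\<close> only
  acts by a similarity on \<open>P S\<^sup>-\<^sup>1\<close>, hence drops out of trace, determinant and spectrum.

  For the minimality, diagonalize \<open>G = V diag(\<lambda>) V\<^sup>*\<close> and \<open>X = W diag(\<mu>) W\<^sup>*\<close> unitarily. The numbers
  \<open>p\<^sub>i\<^sub>j = |(V\<^sup>* W)\<^sub>i\<^sub>j|\<^sup>2\<close> form a doubly stochastic matrix, and with \<open>\<phi>(x) = x - 1 - ln x\<close> the divergence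
  becomes the weighted sum of the \<open>p\<^sub>i\<^sub>j \<phi>((1 + \<mu>\<^sub>j) / (1 + \<lambda>\<^sub>i))\<close> over all \<open>i\<close> and \<open>j\<close>
  (\<open>logdet_div_congruence\<close>). As \<open>\<phi> \<ge> 0\<close>, discarding the columns with \<open>\<mu>\<^sub>j \<noteq> 0\<close> does not increase it. The
  rank constraint leaves at least \<open>n - r\<close> columns, all contributing \<open>\<phi>(1 / (1 + \<lambda>\<^sub>i))\<close>, so row \<open>i\<close> gets
  a total weight in \<open>[0, 1]\<close> and all rows together weigh at least \<open>n - r\<close>. Since \<open>\<phi>(1 / (1 + \<lambda>\<^sub>i))\<close> is
  nonincreasing in \<open>i\<close>, the cheapest way to place that weight is on the last \<open>n - r\<close> rows
  (\<open>doubly_stochastic_tail_bound\<close>). The resulting bound is the value at \<open>X = G\<^sub>r\<close>, where \<open>W = V\<close> and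
  \<open>p\<close> is the identity (\<open>logdet_div_truncation_optimal\<close>).

  For the spectrum, the preconditioned matrix is similar to \<open>diag((1 + \<lambda>\<^sub>i) / (1 + \<mu>\<^sub>i))\<close> where
  \<open>\<mu>\<^sub>i = \<lambda>\<^sub>i\<close> for the first \<open>r\<close> indices and \<open>\<mu>\<^sub>i = 0\<close> for the others
  (\<open>similar_mat_inv_mult_congruence\<close>): \<open>r\<close> ones followed by the \<open>1 + \<lambda>\<^sub>i\<close> with \<open>i > r\<close>. Exactly
  \<open>rank B\<close> of the \<open>\<lambda>\<^sub>i\<close> are nonzero, because \<open>B = Q G Q\<^sup>*\<close>, and they are the first ones.
\<close>

section \<open>Adjoints, inverses and unitary matrices\<close>

lemma dim_mat_adjoint [simp]:
  "dim_row (mat_adjoint M) = dim_col M" "dim_col (mat_adjoint M) = dim_row M"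
  by (auto simp: mat_adjoint_def)

lemma mat_adjoint_carrier:
  "M \<in> carrier_mat m n \<Longrightarrow> mat_adjoint M \<in> carrier_mat n m"
  by (rule carrier_matI) simp_all

lemma mat_adjoint_index [simp]:
  fixes M :: "complex mat"
  shows "i < dim_col M \<Longrightarrow> j < dim_row M \<Longrightarrow> mat_adjoint M $$ (i, j) = cnj (M $$ (j, i))"
  by (simp add: mat_adjoint_def mat_of_rows_index)

lemma mat_adjoint_adjoint [simp]:
  fixes M :: "complex mat"
  shows "mat_adjoint (mat_adjoint M) = M"
  by (rule eq_matI) auto

lemma mat_adjoint_one [simp]: "mat_adjoint (1\<^sub>m n :: complex mat) = 1\<^sub>m n"
  by (rule eq_matI) auto

lemma mat_adjoint_mult:
  fixes M N :: "complex mat"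
  assumes "M \<in> carrier_mat m n" "N \<in> carrier_mat n k"
  shows "mat_adjoint (M * N) = mat_adjoint N * mat_adjoint M"
  by (rule eq_matI) (use assms in \<open>auto simp: scalar_prod_def mult.commute\<close>)

lemma scalar_prod_mat_adjoint:
  fixes M :: "complex mat"
  assumes "M \<in> carrier_mat n n" "v \<in> carrier_vec n" "w \<in> carrier_vec n"
  shows "(M *\<^sub>v v) \<bullet>c w = v \<bullet>c (mat_adjoint M *\<^sub>v w)"
proof -
  have "(M *\<^sub>v v) \<bullet>c w = (\<Sum>i<n. \<Sum>j<n. M $$ (i, j) * v $ j * cnj (w $ i))"
    using assms by (auto simp: scalar_prod_def sum_distrib_right lessThan_atLeast0 intro!: sum.cong)
  also have "\<dots> = (\<Sum>j<n. \<Sum>i<n. M $$ (i, j) * v $ j * cnj (w $ i))"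
    by (rule sum.swap)
  also have "\<dots> = v \<bullet>c (mat_adjoint M *\<^sub>v w)"
    using assms
    by (auto simp: scalar_prod_def sum_distrib_left lessThan_atLeast0 mult_ac intro!: sum.cong)
  finally show ?thesis .
qed

lemma det_nonzero_of_right_inverse:
  fixes A B :: "complex mat"
  assumes "A \<in> carrier_mat n n" "B \<in> carrier_mat n n" "A * B = 1\<^sub>m n"
  shows "det A \<noteq> 0" "det B \<noteq> 0"
  using det_mult[OF assms(1,2)] assms(3) by auto

text \<open>A one-sided inverse of a square matrix over a field is already the inverse.\<close>

lemma mat_inv_eqI:
  assumes M: "M \<in> carrier_mat n n" and N: "N \<in> carrier_mat n n" and MN: "M * N = 1\<^sub>m n"
  shows "mat_inv M = N"
proof -
  have "M \<in> Units (ring_mat TYPE(complex) n undefined)"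
    using M N MN mat_mult_left_right_inverse[OF M N MN] by (auto simp: Units_def ring_mat_def)
  then obtain K where K: "mat_inverse M = Some K"
    using mat_inverse(1)[OF M, of undefined] by fastforce
  from mat_inverse(2)[OF M K] have KM: "K * M = 1\<^sub>m n" and Kc: "K \<in> carrier_mat n n" by auto
  have "K = K * (M * N)" using Kc MN by simp
  also have "\<dots> = (K * M) * N" by (rule assoc_mult_mat[symmetric, OF Kc M N])
  also have "\<dots> = N" using KM N by simp
  finally show ?thesis by (simp add: mat_inv_def K)
qed

lemma mat_inv_of_det:
  assumes M: "M \<in> carrier_mat n n" and d: "det M \<noteq> 0"
  shows "mat_inv M \<in> carrier_mat n n" "M * mat_inv M = 1\<^sub>m n" "mat_inv M * M = 1\<^sub>m n"
proof -
  from det_non_zero_imp_unit[OF M d, of undefined] obtain N where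
    "N \<in> carrier_mat n n" "M * N = 1\<^sub>m n" "N * M = 1\<^sub>m n"
    by (auto simp: Units_def ring_mat_def)
  with mat_inv_eqI[OF M this(1,2)]
  show "mat_inv M \<in> carrier_mat n n" "M * mat_inv M = 1\<^sub>m n" "mat_inv M * M = 1\<^sub>m n" by auto
qed

lemma mult_cancel_inverse:
  fixes A B C :: "complex mat"
  assumes "A \<in> carrier_mat n n" "B \<in> carrier_mat n n" "C \<in> carrier_mat n n" "A * B = 1\<^sub>m n"
  shows "A * (B * C) = C"
  using assms assoc_mult_mat[OF assms(1-3)] by simp

lemma mult_eq_1_similar:
  assumes "P \<in> carrier_mat n n" "R \<in> carrier_mat n n" "P * R = 1\<^sub>m n" "M \<in> carrier_mat n n"
  shows "similar_mat (P * M * R) (M :: complex mat)"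
  unfolding similar_mat_def
  using assms mat_mult_left_right_inverse[OF assms(1-3)]
  by (intro exI[of _ P] exI[of _ R] similar_mat_witI[of _ _ n]) auto

text \<open>Rewriting with associativity for rectangular matrices requires the simplifier to guess intermediate
  dimensions. With a single dimension, instantiated at each use, these rules bring products of square
  matrices into right-nested form.\<close>

lemma square_mat_simps:
  fixes A B C :: "complex mat"
  assumes "A \<in> carrier_mat n n" "B \<in> carrier_mat n n"
  shows "A * B \<in> carrier_mat n n"
    "C \<in> carrier_mat n n \<Longrightarrow> A * B * C = A * (B * C)"
    "mat_adjoint (A * B) = mat_adjoint B * mat_adjoint A"
    "v \<in> carrier_vec n \<Longrightarrow> A *\<^sub>v v \<in> carrier_vec n"
    "v \<in> carrier_vec n \<Longrightarrow> (A * B) *\<^sub>v v = A *\<^sub>v (B *\<^sub>v v)"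
  using assms by (auto intro: mult_carrier_mat assoc_mult_mat mat_adjoint_mult assoc_mult_mat_vec)

abbreviation rdiag :: "nat \<Rightarrow> (nat \<Rightarrow> real) \<Rightarrow> complex mat" where
  "rdiag n d \<equiv> mat_diag n (\<lambda>i. complex_of_real (d i))"

lemma mat_adjoint_rdiag [simp]: "mat_adjoint (rdiag n d) = rdiag n d"
  by (rule eq_matI) (auto simp: mat_diag_def)

definition unitary :: "nat \<Rightarrow> complex mat \<Rightarrow> bool" where
  "unitary n U \<longleftrightarrow> U \<in> carrier_mat n n \<and> mat_adjoint U * U = 1\<^sub>m n"

lemma unitaryD:
  assumes "unitary n U"
  shows "U \<in> carrier_mat n n" "mat_adjoint U \<in> carrier_mat n n"
    "mat_adjoint U * U = 1\<^sub>m n" "U * mat_adjoint U = 1\<^sub>m n"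
  using assms mat_mult_left_right_inverse[of "mat_adjoint U" n U]
  by (auto simp: unitary_def mat_adjoint_carrier)

lemma unitary_mult:
  assumes "unitary n U" "unitary n W"
  shows "unitary n (U * W)"
  using assms unitaryD[OF assms(1)] unitaryD[OF assms(2)]
  by (simp add: unitary_def mat_adjoint_mult[of _ n n _ n] assoc_mult_mat[of _ n n _ n _ n]
      mult_cancel_inverse[of _ n])

lemma unitary_adjoint: "unitary n U \<Longrightarrow> unitary n (mat_adjoint U)"
  by (frule unitaryD(2), drule unitaryD(4)) (simp add: unitary_def)

lemma unitary_conj_conj:
  assumes "unitary n W" "unitary n U" "D \<in> carrier_mat n n"
  shows "W * (U * D * mat_adjoint U) * mat_adjoint W = (W * U) * D * mat_adjoint (W * U)"
  using unitaryD[OF assms(1)] unitaryD[OF assms(2)] assms(3)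
  by (simp add: mat_adjoint_mult[of _ n n _ n] assoc_mult_mat[of _ n n _ n _ n]
      mult_carrier_mat[of _ n n _ n])

lemma one_add_unitary_conj:
  assumes "unitary n U"
  shows "1\<^sub>m n + U * rdiag n d * mat_adjoint U = U * rdiag n (\<lambda>i. 1 + d i) * mat_adjoint U"
proof -
  note U = unitaryD[OF assms]
  note sq = square_mat_simps[where n = n]
  have D: "rdiag n d \<in> carrier_mat n n" by simp
  have "rdiag n (\<lambda>i. 1 + d i) = 1\<^sub>m n + rdiag n d"
    by (rule eq_matI) (auto simp: mat_diag_def)
  then have "U * rdiag n (\<lambda>i. 1 + d i) * mat_adjoint U = (U + U * rdiag n d) * mat_adjoint U"
    using U D by (simp add: mult_add_distrib_mat[of _ n n _ n])
  also have "\<dots> = U * mat_adjoint U + U * rdiag n d * mat_adjoint U"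
    using U D by (intro add_mult_distrib_mat) (auto simp: sq)
  finally show ?thesis using U(4) by simp
qed

text \<open>The diagonal entries of \<open>U U\<^sup>* = I\<close>. Together with the column version this says that the squared
  moduli of the entries of a unitary matrix are doubly stochastic.\<close>

lemma unitary_row_sum:
  assumes "unitary n U" "i < n"
  shows "(\<Sum>j<n. (cmod (U $$ (i, j)))\<^sup>2) = 1"
proof -
  note U = unitaryD[OF assms(1)]
  have "complex_of_real (\<Sum>j<n. (cmod (U $$ (i, j)))\<^sup>2) = (U * mat_adjoint U) $$ (i, i)"
    using U(1) assms(2)
    by (simp add: complex_norm_square scalar_prod_def lessThan_atLeast0 del: of_real_power U(4))
  then show ?thesis using U(4) assms(2) by (simp add: of_real_eq_1_iff del: of_real_sum)
qed

lemma unitary_column_sum: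
  assumes "unitary n U" "j < n"
  shows "(\<Sum>i<n. (cmod (U $$ (i, j)))\<^sup>2) = 1"
  using unitary_row_sum[OF unitary_adjoint[OF assms(1)] assms(2)] unitaryD(1)[OF assms(1)] assms(2)
  by simp

section \<open>Unitary diagonalization of Hermitian matrices\<close>

text \<open>Extend \<open>v\<close> to a basis, orthogonalize by Gram--Schmidt, which leaves the first vector in place, and
  normalize.\<close>

lemma unitary_completion:
  fixes v :: "complex vec"
  assumes v: "v \<in> carrier_vec n" and v0: "v \<noteq> 0\<^sub>v n"
  obtains W c where "unitary n W" "c \<noteq> 0" "col W 0 = c \<cdot>\<^sub>v v"
proof -
  interpret cof_vec_space n "TYPE(complex)" .
  have n: "0 < n" using v v0 by (cases n) auto
  define ws where "ws = gram_schmidt n (basis_completion v)"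
  note bc = basis_completion[OF v v0]
  note gs = gram_schmidt_result[OF bc(2,4,5) ws_def]
  have len: "length ws = n" using gs(4) bc(6) by simp
  have ws: "ws ! i \<in> carrier_vec n" if "i < n" for i using gs(3) len that nth_mem by blast
  obtain vs where "basis_completion v = v # vs" using bc(6,7) n by (cases "basis_completion v") auto
  then have "hd ws = v" using gram_schmidt_hd[OF v, of vs] by (simp add: ws_def)
  then have ws0: "ws ! 0 = v" using len n by (cases ws) auto
  define s where "s i = 1 / sqrt (Re (ws ! i \<bullet>c ws ! i))" for i
  have pos: "0 < Re (ws ! i \<bullet>c ws ! i)" "Im (ws ! i \<bullet>c ws ! i) = 0" if "i < n" for i
  proof -
    have "ws ! i \<bullet>c ws ! i \<noteq> 0" using corthogonalD[OF gs(2), of i i] that len by auto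
    moreover have "ws ! i \<bullet>c ws ! i \<ge> 0" by (rule conjugate_square_ge_0_vec)
    ultimately show "0 < Re (ws ! i \<bullet>c ws ! i)" "Im (ws ! i \<bullet>c ws ! i) = 0"
      by (auto simp: less_eq_complex_def complex_eq_iff)
  qed
  define W where "W = mat n n (\<lambda>(a, i). complex_of_real (s i) * ws ! i $ a)"
  have Wc: "W \<in> carrier_mat n n" by (simp add: W_def)
  have "mat_adjoint W * W = 1\<^sub>m n"
  proof (rule eq_matI)
    fix i j assume "i < dim_row (1\<^sub>m n :: complex mat)" "j < dim_col (1\<^sub>m n :: complex mat)"
    then have i: "i < n" and j: "j < n" by auto
    have "(mat_adjoint W * W) $$ (i, j) =
        (\<Sum>a<n. cnj (complex_of_real (s i) * ws ! i $ a) * (complex_of_real (s j) * ws ! j $ a))"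
      using i j by (simp add: W_def scalar_prod_def lessThan_atLeast0)
    also have "\<dots> = complex_of_real (s i * s j) * (ws ! j \<bullet>c ws ! i)"
      using ws[OF i] ws[OF j]
      by (auto simp: scalar_prod_def lessThan_atLeast0 sum_distrib_left mult_ac intro!: sum.cong)
    also have "\<dots> = 1\<^sub>m n $$ (i, j)"
    proof (cases "i = j")
      case True
      have "ws ! j \<bullet>c ws ! i = complex_of_real (Re (ws ! i \<bullet>c ws ! i))"
        using True pos[OF i] by (simp add: complex_eq_iff)
      moreover have "s i * s i * Re (ws ! i \<bullet>c ws ! i) = 1"
        using pos(1)[OF i] by (simp add: s_def)
      ultimately show ?thesis using True i
        by (metis index_one_mat(1) of_real_1 of_real_mult)
    next
      case False
      then have "ws ! j \<bullet>c ws ! i = 0" using corthogonalD[OF gs(2), of j i] i j len by auto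
      then show ?thesis using False i j by simp
    qed
    finally show "(mat_adjoint W * W) $$ (i, j) = 1\<^sub>m n $$ (i, j)" .
  qed (use Wc in auto)
  then have "unitary n W" using Wc by (simp add: unitary_def)
  moreover have "complex_of_real (s 0) \<noteq> 0" using pos(1)[OF n] by (simp add: s_def)
  moreover have "col W 0 = complex_of_real (s 0) \<cdot>\<^sub>v v"
    by (rule eq_vecI) (use n v ws0 in \<open>auto simp: W_def\<close>)
  ultimately show ?thesis by (rule that)
qed

lemma mat_adjoint_four_block:
  fixes A B C D :: "complex mat"
  assumes "A \<in> carrier_mat k k" "B \<in> carrier_mat k l" "C \<in> carrier_mat l k" "D \<in> carrier_mat l l"
  shows "mat_adjoint (four_block_mat A B C D) =
    four_block_mat (mat_adjoint A) (mat_adjoint C) (mat_adjoint B) (mat_adjoint D)"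
  by (rule eq_matI) (use assms in auto)

lemma mult_block_diag:
  fixes A A' B B' :: "complex mat"
  assumes "A \<in> carrier_mat k k" "A' \<in> carrier_mat k k" "B \<in> carrier_mat m m" "B' \<in> carrier_mat m m"
  shows "four_block_mat A (0\<^sub>m k m) (0\<^sub>m m k) B * four_block_mat A' (0\<^sub>m k m) (0\<^sub>m m k) B' =
    four_block_mat (A * A') (0\<^sub>m k m) (0\<^sub>m m k) (B * B')"
  using mult_four_block_mat[OF assms(1) zero_carrier_mat zero_carrier_mat assms(3)
      assms(2) zero_carrier_mat zero_carrier_mat assms(4)]
    mult_carrier_mat[OF assms(1,2)] mult_carrier_mat[OF assms(3,4)] assms by simp

text \<open>Induction on the dimension: a unitary matrix whose first column is an eigenvector deflates \<open>A\<close> to a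
  matrix with first column \<open>(e, 0, \<dots>, 0)\<close>. Hermitian symmetry makes \<open>e\<close> real and clears the first row
  as well, so the rest is a Hermitian block of smaller size.\<close>

theorem hermitian_unitary_diagonalization:
  assumes "A \<in> carrier_mat n n" "mat_adjoint A = A"
  obtains U d where "unitary n U" "A = U * rdiag n d * mat_adjoint U"
proof -
  have "\<exists>U d. unitary n U \<and> A = U * rdiag n d * mat_adjoint U"
    using assms
  proof (induction n arbitrary: A)
    case 0
    have "unitary 0 (1\<^sub>m 0)" by (simp add: unitary_def)
    moreover have "A = 1\<^sub>m 0 * rdiag 0 d * mat_adjoint (1\<^sub>m 0)" for d
      by (rule eq_matI) (use 0 in auto)
    ultimately show ?case by blast
  next
    case (Suc m)
    let ?n = "Suc m"
    note A = Suc.prems(1)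
    obtain as where as: "char_poly A = (\<Prod>a\<leftarrow>as. [:- a, 1:])" "length as = ?n"
      using char_poly_factorized[OF A] by blast
    then obtain e es where "as = e # es" by (cases as) auto
    then have "eigenvalue A e" using as(1) by (simp add: eigenvalue_root_char_poly[OF A])
    then obtain v where v: "v \<in> carrier_vec ?n" "v \<noteq> 0\<^sub>v ?n" and Av: "A *\<^sub>v v = e \<cdot>\<^sub>v v"
      using A by (auto simp: eigenvalue_def eigenvector_def)
    obtain W c where W: "unitary ?n W" and c: "c \<noteq> 0" and W0: "col W 0 = c \<cdot>\<^sub>v v"
      using unitary_completion[OF v] .
    note Wc = unitaryD[OF W]
    \<comment> \<open>The deflated matrix; its first column is computed from \<open>A v = e v\<close> and \<open>W\<^sup>* W = I\<close>.\<close>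
    define A' where "A' = mat_adjoint W * A * W"
    have A': "A' \<in> carrier_mat ?n ?n" using A Wc by (simp add: A'_def)
    have herm: "mat_adjoint A' = A'"
      using A Wc Suc.prems(2)
      by (simp add: A'_def mat_adjoint_mult[of _ ?n ?n _ ?n] assoc_mult_mat[of _ ?n ?n _ ?n _ ?n])
    have A'h: "A' $$ (i, j) = cnj (A' $$ (j, i))" if "i < ?n" "j < ?n" for i j
      using mat_adjoint_index[of i A' j] that A' herm by auto
    have WA: "mat_adjoint W * A \<in> carrier_mat ?n ?n" using Wc(2) A by (rule mult_carrier_mat)
    have "col A' 0 = mat_adjoint W *\<^sub>v (A *\<^sub>v col W 0)"
      unfolding A'_def col_mult2[OF WA Wc(1) zero_less_Suc]
      by (rule assoc_mult_mat_vec[OF Wc(2) A]) (simp add: W0 v(1))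
    also have "A *\<^sub>v col W 0 = e \<cdot>\<^sub>v col W 0"
      using A v(1) Av by (simp add: W0 mult_mat_vec[of _ ?n ?n] smult_smult_assoc mult.commute)
    also have "mat_adjoint W *\<^sub>v (e \<cdot>\<^sub>v col W 0) = e \<cdot>\<^sub>v col (mat_adjoint W * W) 0"
      unfolding col_mult2[OF Wc(2,1) zero_less_Suc]
      by (rule mult_mat_vec[OF Wc(2)]) (simp add: W0 v(1))
    also have "\<dots> = e \<cdot>\<^sub>v unit_vec ?n 0" using Wc by simp
    finally have col0: "col A' 0 = e \<cdot>\<^sub>v unit_vec ?n 0" .
    have A'0: "A' $$ (i, 0) = (if i = 0 then e else 0)" if "i < ?n" for i
      using arg_cong[OF col0, of "\<lambda>x. x $ i"] that A' by (auto split: if_splits)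
    have "e = cnj e" using A'0[of 0] A'h[of 0 0] by simp
    then have e: "complex_of_real (Re e) = e" by (simp add: complex_eq_iff)
    define B where "B = mat m m (\<lambda>(i, j). A' $$ (Suc i, Suc j))"
    have B: "B \<in> carrier_mat m m" by (simp add: B_def)
    have "mat_adjoint B = B"
      by (rule eq_matI) (auto simp: B_def A'h[symmetric])
    from Suc.IH[OF B this] obtain U d where U: "unitary m U" and Bd: "B = U * rdiag m d * mat_adjoint U"
      by blast
    note Uc = unitaryD[OF U]
    define d' where "d' i = (case i of 0 \<Rightarrow> Re e | Suc j \<Rightarrow> d j)" for i
    let ?E = "mat 1 1 (\<lambda>_. e) :: complex mat"
    let ?U = "four_block_mat (1\<^sub>m 1) (0\<^sub>m 1 m) (0\<^sub>m m 1) U"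
    have z: "mat_adjoint (0\<^sub>m k l :: complex mat) = 0\<^sub>m l k" for k l by (rule eq_matI) auto
    have adjU: "mat_adjoint ?U = four_block_mat (1\<^sub>m 1) (0\<^sub>m 1 m) (0\<^sub>m m 1) (mat_adjoint U)"
      using Uc by (subst mat_adjoint_four_block[of _ 1 _ m]) (auto simp: z)
    have Ucar: "?U \<in> carrier_mat ?n ?n"
      using four_block_carrier_mat[OF one_carrier_mat[of 1] Uc(1)] by simp
    have "mat_adjoint ?U * ?U = four_block_mat (1\<^sub>m 1) (0\<^sub>m 1 m) (0\<^sub>m m 1) (1\<^sub>m m)"
      unfolding adjU mult_block_diag[OF one_carrier_mat one_carrier_mat Uc(2,1)]
      by (simp add: Uc(3))
    also have "\<dots> = 1\<^sub>m ?n" by (rule eq_matI) auto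
    finally have U': "unitary ?n ?U" using Ucar by (simp add: unitary_def)
    have Ec: "?E \<in> carrier_mat 1 1" by simp
    have UD: "U * rdiag m d \<in> carrier_mat m m" by (rule mult_carrier_mat[OF Uc(1) mat_diag_dim])
    have D: "rdiag ?n d' = four_block_mat ?E (0\<^sub>m 1 m) (0\<^sub>m m 1) (rdiag m d)"
      by (rule eq_matI) (auto simp: mat_diag_def d'_def e split: nat.splits)
    have "?U * rdiag ?n d' * mat_adjoint ?U =
        four_block_mat ?E (0\<^sub>m 1 m) (0\<^sub>m m 1) (U * rdiag m d * mat_adjoint U)"
      unfolding adjU D mult_block_diag[OF one_carrier_mat Ec Uc(1) mat_diag_dim]
        left_mult_one_mat[OF Ec] mult_block_diag[OF Ec one_carrier_mat UD Uc(2)]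
        right_mult_one_mat[OF Ec] ..
    also have "\<dots> = A'"
    proof (rule eq_matI)
      fix i j assume ij: "i < dim_row A'" "j < dim_col A'"
      show "four_block_mat ?E (0\<^sub>m 1 m) (0\<^sub>m m 1) (U * rdiag m d * mat_adjoint U) $$ (i, j) = A' $$ (i, j)"
        unfolding Bd[symmetric] using ij A' B A'0[of i] A'0[of j] A'h[of i j] e
        by (cases i; cases j) (auto simp: B_def)
    qed (use A' Uc in auto)
    finally have A'd: "A' = ?U * rdiag ?n d' * mat_adjoint ?U" ..
    have "W * A' * mat_adjoint W = A"
      using A Wc by (simp add: A'_def assoc_mult_mat[of _ ?n ?n _ ?n _ ?n] mult_cancel_inverse[of _ ?n])
    then have "A = (W * ?U) * rdiag ?n d' * mat_adjoint (W * ?U)"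
      unfolding A'd unitary_conj_conj[OF W U' mat_diag_dim] ..
    with unitary_mult[OF W U'] show ?case by blast
  qed
  then show ?thesis using that by blast
qed

section \<open>Definiteness\<close>

lemma hpd_imp_det_nonzero:
  assumes "hpd n A"
  shows "det A \<noteq> 0"
proof
  assume "det A = 0"
  moreover have A: "A \<in> carrier_mat n n" using assms by (simp add: hpd_def)
  ultimately obtain v where v: "v \<in> carrier_vec n" "v \<noteq> 0\<^sub>v n" "A *\<^sub>v v = 0\<^sub>v n"
    using det_0_iff_vec_prod_zero[OF A] by blast
  have "0 < (A *\<^sub>v v) \<bullet>c v" using assms v(1,2) by (simp add: hpd_def)
  then show False using v by simp
qed

lemma hpsd_congruence:
  assumes B: "hpsd n B" and K: "K \<in> carrier_mat n n"
  shows "hpsd n (K * B * mat_adjoint K)"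
  unfolding hpsd_def
proof (intro conjI ballI)
  have Bc: "B \<in> carrier_mat n n" and Bh: "mat_adjoint B = B" using B by (auto simp: hpsd_def)
  have Ka: "mat_adjoint K \<in> carrier_mat n n" using K by (rule mat_adjoint_carrier)
  note sq = square_mat_simps[where n = n]
  show "K * B * mat_adjoint K \<in> carrier_mat n n" using K Ka Bc by (simp add: sq)
  show "mat_adjoint (K * B * mat_adjoint K) = K * B * mat_adjoint K"
    using K Ka Bc Bh by (simp add: sq)
  fix v :: "complex vec" assume v: "v \<in> carrier_vec n"
  define w where "w = mat_adjoint K *\<^sub>v v"
  have w: "w \<in> carrier_vec n" using Ka v by (simp add: w_def sq)
  have "(K * B * mat_adjoint K) *\<^sub>v v = K *\<^sub>v (B *\<^sub>v w)"
    using K Ka Bc v by (simp add: w_def sq)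
  then have "((K * B * mat_adjoint K) *\<^sub>v v) \<bullet>c v = (B *\<^sub>v w) \<bullet>c w"
    using scalar_prod_mat_adjoint[OF K _ v, of "B *\<^sub>v w"] Bc w by (simp add: w_def sq)
  then show "0 \<le> ((K * B * mat_adjoint K) *\<^sub>v v) \<bullet>c v" using B w by (simp add: hpsd_def)
qed

lemma unitary_conj_hpsd:
  assumes "unitary n U" and "\<And>i. i < n \<Longrightarrow> 0 \<le> d i"
  shows "hpsd n (U * rdiag n d * mat_adjoint U)"
  unfolding hpsd_def
proof (intro conjI ballI)
  note U = unitaryD[OF assms(1)]
  have D: "rdiag n d \<in> carrier_mat n n" by simp
  show "U * rdiag n d * mat_adjoint U \<in> carrier_mat n n" using U D by (intro mult_carrier_mat)
  show "mat_adjoint (U * rdiag n d * mat_adjoint U) = U * rdiag n d * mat_adjoint U"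
    using U D by (simp add: square_mat_simps[where n = n])
  fix v :: "complex vec" assume v: "v \<in> carrier_vec n"
  define u where "u = mat_adjoint U *\<^sub>v v"
  have u: "u \<in> carrier_vec n" using U v by (simp add: u_def)
  have "(U * rdiag n d * mat_adjoint U) *\<^sub>v v = U *\<^sub>v (rdiag n d *\<^sub>v u)"
    using U D v by (simp add: u_def square_mat_simps[where n = n])
  then have "((U * rdiag n d * mat_adjoint U) *\<^sub>v v) \<bullet>c v = (rdiag n d *\<^sub>v u) \<bullet>c u"
    using scalar_prod_mat_adjoint[OF U(1) _ v, of "rdiag n d *\<^sub>v u"] D u
    by (simp add: u_def[symmetric] mult_mat_vec_carrier[of _ n n])
  also have "\<dots> = (\<Sum>i<n. complex_of_real (d i) * (u $ i * cnj (u $ i)))"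
    using u by (auto simp: scalar_prod_def mat_diag_def lessThan_atLeast0 if_distrib[of "\<lambda>x. x * _"]
        cong: if_cong intro!: sum.cong)
  also have "\<dots> = complex_of_real (\<Sum>i<n. d i * (cmod (u $ i))\<^sup>2)"
    by (simp add: complex_norm_square del: of_real_power)
  also have "0 \<le> \<dots>"
    using assms(2) by (auto simp: less_eq_complex_def intro!: sum_nonneg)
  finally show "0 \<le> ((U * rdiag n d * mat_adjoint U) *\<^sub>v v) \<bullet>c v" .
qed

text \<open>Evaluate the quadratic form at the \<open>i\<close>-th column of \<open>U\<close>.\<close>

lemma hpsd_unitary_conj_nonneg:
  assumes U: "unitary n U" and ps: "hpsd n (U * rdiag n d * mat_adjoint U)" and i: "i < n"
  shows "0 \<le> d i"
proof -
  note Uc = unitaryD[OF U]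
  have D: "rdiag n d \<in> carrier_mat n n" by simp
  let ?e = "unit_vec n i :: complex vec"
  define v where "v = U *\<^sub>v ?e"
  have v: "v \<in> carrier_vec n" using Uc by (simp add: v_def)
  have Uv: "mat_adjoint U *\<^sub>v v = ?e"
    using Uc by (simp add: v_def assoc_mult_mat_vec[of _ n n _ n, symmetric])
  have "(U * rdiag n d * mat_adjoint U) *\<^sub>v v = U *\<^sub>v (rdiag n d *\<^sub>v ?e)"
    using Uc D v Uv by (simp add: square_mat_simps[where n = n])
  then have "((U * rdiag n d * mat_adjoint U) *\<^sub>v v) \<bullet>c v = (rdiag n d *\<^sub>v ?e) \<bullet>c ?e"
    using scalar_prod_mat_adjoint[OF Uc(1) _ v, of "rdiag n d *\<^sub>v ?e"] D Uv
    by (simp add: mult_mat_vec_carrier[of _ n n])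
  also have "\<dots> = complex_of_real (d i)"
    using i by (simp add: mat_diag_def scalar_prod_def unit_vec_def if_distrib cong: if_cong)
  finally show ?thesis
    using ps v by (auto simp: hpsd_def less_eq_complex_def)
qed

section \<open>Ranks of diagonalized matrices\<close>

text \<open>The right factor does not change the column space, and the column space of \<open>P diag(d)\<close> is spanned by
  the columns of \<open>P\<close> with \<open>d i \<noteq> 0\<close>, which are linearly independent.\<close>

lemma rank_mult_rdiag_mult:
  assumes P: "P \<in> carrier_mat n n" "det P \<noteq> 0" and R: "R \<in> carrier_mat n n" "det R \<noteq> 0"
  shows "vec_space.rank n (P * rdiag n d * R) = card {i. i < n \<and> d i \<noteq> 0}"
proof -
  interpret vec_space "TYPE(complex)" n .
  have D: "rdiag n d \<in> carrier_mat n n" by simp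
  have PD: "P * rdiag n d \<in> carrier_mat n n" using P(1) D by (rule mult_carrier_mat)
  have PDR: "P * rdiag n d * R \<in> carrier_mat n n" using PD R(1) by (rule mult_carrier_mat)
  note R' = mat_inv_of_det[OF R]
  have rankP: "rank P = n" using det_rank_iff[OF P(1)] P(2) by simp
  have dist: "distinct (cols P)" using non_distinct_low_rank[OF P(1)] rankP by auto
  have indpt: "lin_indpt (set (cols P))" by (rule full_rank_lin_indpt[OF P(1) rankP dist])
  let ?N = "{i. i < n \<and> d i \<noteq> 0}"
  define S where "S = col P ` ?N"
  have S: "S \<subseteq> set (cols P)" using P(1) by (auto simp: S_def cols_def)
  have cP: "set (cols P) \<subseteq> carrier_vec n" using cols_dim[of P] P(1) by auto
  have Sc: "S \<subseteq> carrier_vec n" using S cP by blast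
  have inj: "inj_on (col P) ?N"
  proof (rule inj_onI)
    fix i j assume "i \<in> ?N" "j \<in> ?N" "col P i = col P j"
    then show "i = j" using dist P(1) nth_eq_iff_index_eq[OF dist] by simp
  qed
  have col_PD: "col (P * rdiag n d) i = complex_of_real (d i) \<cdot>\<^sub>v col P i" if "i < n" for i
    by (rule eq_vecI) (use that P(1) in \<open>auto simp: mat_diag_mult_right[OF P(1)]\<close>)
  have span_PD: "span (set (cols (P * rdiag n d))) = span S"
  proof
    have "set (cols (P * rdiag n d)) \<subseteq> span S"
    proof
      fix x assume "x \<in> set (cols (P * rdiag n d))"
      then obtain i where i: "i < n" and x: "x = complex_of_real (d i) \<cdot>\<^sub>v col P i"
        using PD col_PD by (auto simp: cols_def)
      show "x \<in> span S"
      proof (cases "d i = 0")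
        case True
        then have "x = 0\<^sub>v n" using P(1) i by (auto simp: x)
        then have "x = lincomb (\<lambda>_. 0) {}" by (simp add: lincomb_empty module_vec_simps)
          then show ?thesis by (rule in_spanI) auto
      next
        case False
        then have "col P i \<in> S" using i by (auto simp: S_def)
        then show ?thesis unfolding x using Sc span_mem by (intro smult_in_span) auto
      qed
    qed
    then show "span (set (cols (P * rdiag n d))) \<subseteq> span S" by (rule span_subsetI[OF Sc])
  next
    have cPD: "set (cols (P * rdiag n d)) \<subseteq> carrier_vec n" 
      using cols_dim[of "P * rdiag n d"] by (simp only: carrier_matD(1)[OF PD])
    have "S \<subseteq> span (set (cols (P * rdiag n d)))"
    proof
      fix x assume "x \<in> S"
      then obtain i where i: "i < n" "d i \<noteq> 0" and x: "x = col P i" by (auto simp: S_def)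
      have "x = complex_of_real (1 / d i) \<cdot>\<^sub>v col (P * rdiag n d) i"
        using i P(1) by (auto simp: x col_PD smult_smult_assoc)
      moreover have "col (P * rdiag n d) i \<in> set (cols (P * rdiag n d))"
        using i PD by (auto simp: cols_def)
      ultimately show "x \<in> span (set (cols (P * rdiag n d)))"
        using cPD span_mem by (auto intro!: smult_in_span)
    qed
    then show "span S \<subseteq> span (set (cols (P * rdiag n d)))" by (rule span_subsetI[OF cPD])
  qed
  have "col_space (P * rdiag n d * R) = col_space (P * rdiag n d)"
  proof -
    have 1: "(P * rdiag n d * R) *\<^sub>v x = (P * rdiag n d) *\<^sub>v (R *\<^sub>v x)"
      if "x \<in> carrier_vec n" for x
      by (rule assoc_mult_mat_vec[OF PD R(1) that])
    have 2: "(P * rdiag n d) *\<^sub>v x = (P * rdiag n d * R) *\<^sub>v (mat_inv R *\<^sub>v x)"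
      if "x \<in> carrier_vec n" for x
    proof -
      have "R *\<^sub>v (mat_inv R *\<^sub>v x) = x"
        using assoc_mult_mat_vec[OF R(1) R'(1) that] R'(2) that by simp
      then show ?thesis using 1[OF mult_mat_vec_carrier[OF R'(1) that]] by simp
    qed
    have "(\<exists>x\<in>carrier_vec n. (P * rdiag n d * R) *\<^sub>v x = y) \<longleftrightarrow>
        (\<exists>x\<in>carrier_vec n. (P * rdiag n d) *\<^sub>v x = y)" (is "?l \<longleftrightarrow> ?r") for y
    proof
      assume ?l
      then obtain x where x: "x \<in> carrier_vec n" "(P * rdiag n d * R) *\<^sub>v x = y" by blast
      show ?r using 1[OF x(1)] x(2) by (intro bexI[OF _ mult_mat_vec_carrier[OF R(1) x(1)]]) simp
    next
      assume ?r
      then obtain x where x: "x \<in> carrier_vec n" "(P * rdiag n d) *\<^sub>v x = y" by blast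
      show ?l using 2[OF x(1)] x(2) by (intro bexI[OF _ mult_mat_vec_carrier[OF R'(1) x(1)]]) simp
    qed
    then show ?thesis
      unfolding col_space_eq[OF PDR] col_space_eq[OF PD] carrier_matD[OF PDR] carrier_matD[OF PD]
      by (simp only:)
  qed
  then have "span (set (cols (P * rdiag n d * R))) = span S"
    using span_PD by (simp add: col_space_def)
  moreover have "vectorspace.dim class_ring (span_vs S) = card S"
  proof (rule dim_span)
    have "lin_indpt S" using indpt S supset_ld_is_ld by blast
    then show "maximal S (\<lambda>T. T \<subseteq> S \<and> lin_indpt T)" by (auto simp: maximal_def)
  qed (use Sc in \<open>auto simp: S_def\<close>)
  ultimately show ?thesis
    using card_image[OF inj] by (simp add: rank_def S_def)
qed

lemma rank_unitary_conj:
  assumes "unitary n U"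
  shows "vec_space.rank n (U * rdiag n d * mat_adjoint U) = card {i. i < n \<and> d i \<noteq> 0}"
  using rank_mult_rdiag_mult[of U n "mat_adjoint U" d] unitaryD[OF assms]
    det_nonzero_of_right_inverse[OF unitaryD(2,1,3)[OF assms]] by auto

lemma rank_congruence_unitary_conj:
  assumes K: "K \<in> carrier_mat n n" "det K \<noteq> 0" and U: "unitary n U"
  shows "vec_space.rank n (K * (U * rdiag n d * mat_adjoint U) * mat_adjoint K) =
    card {i. i < n \<and> d i \<noteq> 0}"
proof -
  note Uc = unitaryD[OF U]
  note sq = square_mat_simps[where n = n]
  have Ka: "mat_adjoint K \<in> carrier_mat n n" using K(1) by (rule mat_adjoint_carrier)
  note Ki = mat_inv_of_det[OF K]
  have "mat_adjoint K * mat_adjoint (mat_inv K) = 1\<^sub>m n"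
    using sq(3)[OF Ki(1) K(1)] Ki(3) by simp
  then have "det (mat_adjoint K) \<noteq> 0"
    using det_nonzero_of_right_inverse(1)[OF Ka mat_adjoint_carrier[OF Ki(1)]] by simp
  moreover note det_nonzero_of_right_inverse[OF Uc(2,1,3)]
  ultimately have "det (K * U) \<noteq> 0" "det (mat_adjoint U * mat_adjoint K) \<noteq> 0"
    using K Ka Uc by (auto simp: det_mult[of _ n])
  moreover have "K * (U * rdiag n d * mat_adjoint U) * mat_adjoint K =
      (K * U) * rdiag n d * (mat_adjoint U * mat_adjoint K)"
    using K Ka Uc by (simp add: sq)
  ultimately show ?thesis
    using rank_mult_rdiag_mult[of "K * U" n "mat_adjoint U * mat_adjoint K" d] K Ka Uc
    by (simp add: sq)
qed

text \<open>For the nonincreasing eigenvalues of a positive semidefinite matrix, the nonzero ones come first, so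
  that the rank alone tells which of them vanish.\<close>

lemma antimono_support_initial:
  fixes l :: "nat \<Rightarrow> real"
  assumes nn: "\<And>i. i < n \<Longrightarrow> 0 \<le> l i" and anti: "\<And>i j. i \<le> j \<Longrightarrow> j < n \<Longrightarrow> l j \<le> l i"
    and i: "i < n"
  shows "l i \<noteq> 0 \<longleftrightarrow> i < card {i. i < n \<and> l i \<noteq> 0}" (is "_ \<longleftrightarrow> i < card ?N")
proof
  assume "l i \<noteq> 0"
  then have "{..i} \<subseteq> ?N"
    using nn[OF i] anti[OF _ i] i by force
  then have "card {..i} \<le> card ?N" by (intro card_mono) auto
  then show "i < card ?N" by simp
next
  assume *: "i < card ?N"
  show "l i \<noteq> 0"
  proof
    assume "l i = 0"
    then have "?N \<subseteq> {..<i}"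
      using nn anti by (smt (verit) lessThan_iff mem_Collect_eq not_less subsetI)
    then have "card ?N \<le> card {..<i}" by (intro card_mono) auto
    then show False using * by simp
  qed
qed

section \<open>Ordered eigenvalues\<close>

lemma proots_char_poly_similar_rdiag:
  assumes "similar_mat M (rdiag n t)"
  shows "proots (char_poly M) = image_mset (\<lambda>i. complex_of_real (t i)) (mset [0..<n])"
proof -
  have ut: "upper_triangular (rdiag n t)" by (auto simp: mat_diag_def)
  have dm: "diag_mat (rdiag n t) = map (\<lambda>i. complex_of_real (t i)) [0..<n]"
    by (auto simp: diag_mat_def mat_diag_def)
  have "char_poly M = (\<Prod>a\<leftarrow>map (\<lambda>i. complex_of_real (t i)) [0..<n]. [:- a, 1:])"
    using char_poly_similar[OF assms] char_poly_upper_triangular[OF mat_diag_dim ut] by (simp add: dm)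
  moreover have "proots (\<Prod>a\<leftarrow>as. [:- a, 1:]) = mset as" for as :: "complex list"
  proof (induction as)
    case (Cons a as)
    have "(\<Prod>a\<leftarrow>as. [:- a, 1:]) \<noteq> (0 :: complex poly)" by (auto simp: prod_list_zero_iff)
    then have "proots (\<Prod>a\<leftarrow>a # as. [:- a, 1:]) = proots [:- a, 1:] + mset as"
      using Cons by (simp add: proots_mult del: mult_pCons_left)
    then show ?case by simp
  qed simp
  ultimately show ?thesis by (simp only: mset_map)
qed

lemma ordered_eigvals_similar_rdiag:
  assumes "similar_mat M (rdiag n t)"
  shows "ordered_eigvals M = rev (sort (map t [0..<n]))"
proof -
  have "image_mset Re (proots (char_poly M)) = mset (map t [0..<n])"
    unfolding proots_char_poly_similar_rdiag[OF assms] by (simp add: multiset.map_comp comp_def)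
  then show ?thesis by (simp only: ordered_eigvals_def sorted_list_of_multiset_mset)
qed

text \<open>The eigenvalues of a matrix that is similar to a diagonal one are its diagonal entries; any
  nonincreasing rearrangement of these is the ordered list.\<close>

lemma ordered_eigvals_similar_rdiag_eqI:
  assumes "similar_mat M (rdiag n t)" and "mset (map s [0..<n]) = mset (map t [0..<n])"
    and "\<And>i j. i \<le> j \<Longrightarrow> j < n \<Longrightarrow> s j \<le> s i"
  shows "ordered_eigvals M = map s [0..<n]"
proof -
  have "sorted (rev (map s [0..<n]))"
    using assms(3) by (auto simp: sorted_rev_iff_nth_mono)
  then have "sort (map t [0..<n]) = rev (map s [0..<n])"
    using assms(2) by (intro properties_for_sort) auto
  then show ?thesis by (simp add: ordered_eigvals_similar_rdiag[OF assms(1)])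
qed

lemma eigval_antimono:
  assumes "M \<in> carrier_mat n n" "i \<le> j" "j < n"
  shows "eigval (Suc j) M \<le> eigval (Suc i) M"
proof -
  have "length (ordered_eigvals M) = size (proots (char_poly M))"
    unfolding ordered_eigvals_def by (simp add: size_mset[symmetric] del: size_mset)
  also have "\<dots> = n" using degree_monic_char_poly[OF assms(1)] by (simp add: size_proots_complex)
  finally have "length (ordered_eigvals M) = n" .
  moreover have "sorted (rev (ordered_eigvals M))" by (simp add: ordered_eigvals_def)
  ultimately show ?thesis
    using sorted_rev_nth_mono[of "ordered_eigvals M" i j] assms by (simp add: eigval_def)
qed

text \<open>This moves \<open>r\<close> leading copies of \<open>c\<close> to the end, which sorts the spectrum of the preconditioned
  matrix, where \<open>c = 1\<close> is the least eigenvalue.\<close>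

lemma mset_shifted_range:
  assumes "r \<le> n"
  shows "mset (map (\<lambda>i. if i < n - r then g (i + r) else c) [0..<n]) =
    mset (map (\<lambda>i. if i < r then c else g i) [0..<n])"
proof -
  have 1: "[0..<n] = [0..<n - r] @ [n - r..<n]" and 2: "[0..<n] = [0..<r] @ [r..<n]"
    using upt_add_eq_append[of 0 "n - r" r] upt_add_eq_append[of 0 r "n - r"] assms by auto
  have "map (\<lambda>i. if i < n - r then g (i + r) else c) [0..<n] = map g [r..<n] @ replicate r c"
    unfolding 1 map_append using assms by (intro arg_cong2[where f = append] nth_equalityI) (auto simp: add.commute)
  moreover have "map (\<lambda>i. if i < r then c else g i) [0..<n] = replicate r c @ map g [r..<n]"
    unfolding 2 map_append using assms by (intro arg_cong2[where f = append] nth_equalityI) auto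
  ultimately show ?thesis by (simp add: union_commute)
qed

section \<open>Truncated singular value decompositions\<close>

lemma spectral_sum_eq_unitary_conj:
  fixes v :: "nat \<Rightarrow> complex vec"
  assumes "M \<in> carrier_mat n n" "k \<le> n"
  defines "V \<equiv> mat n n (\<lambda>(a, j). v (Suc j) $ a)"
  shows "spectral_sum M v k =
    V * rdiag n (\<lambda>j. if j < k then eigval (Suc j) M else 0) * mat_adjoint V"
proof (rule eq_matI)
  let ?d = "\<lambda>j. if j < k then eigval (Suc j) M else 0"
  let ?R = "V * rdiag n ?d * mat_adjoint V"
  have V: "V \<in> carrier_mat n n" by (simp add: V_def)
  show "dim_row (spectral_sum M v k) = dim_row ?R" "dim_col (spectral_sum M v k) = dim_col ?R"
    using assms(1) V by (auto simp: spectral_sum_def)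
  fix a b assume "a < dim_row ?R" "b < dim_col ?R"
  then have ab: "a < n" "b < n" using V by auto
  have "?R $$ (a, b) = (\<Sum>j<n. v (Suc j) $ a * complex_of_real (?d j) * cnj (v (Suc j) $ b))"
    unfolding mat_diag_mult_right[OF V] using ab by (simp add: V_def scalar_prod_def lessThan_atLeast0)
  also have "\<dots> = (\<Sum>j<k. v (Suc j) $ a * complex_of_real (?d j) * cnj (v (Suc j) $ b))"
    using assms(2) by (intro sum.mono_neutral_right) auto
  also have "\<dots> = spectral_sum M v k $$ (a, b)"
    using ab assms(1) by (auto simp: spectral_sum_def sum.atLeast1_atMost_eq intro!: sum.cong)
  finally show "spectral_sum M v k $$ (a, b) = ?R $$ (a, b)" ..
qed

text \<open>The eigenvectors \<open>v 1, \<dots>, v n\<close> become the columns \<open>0, \<dots>, n - 1\<close> of a unitary matrix. The truncation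
  is then the same conjugation, applied to the diagonal with all but its first \<open>r\<close> entries set to zero.\<close>

lemma truncated_svd_unitary:
  assumes M: "M \<in> carrier_mat n n" and r: "r \<le> n" and svd: "is_truncated_svd n r M Mr"
  obtains V where "unitary n V"
    "M = V * rdiag n (\<lambda>i. eigval (Suc i) M) * mat_adjoint V"
    "Mr = V * rdiag n (\<lambda>i. if i < r then eigval (Suc i) M else 0) * mat_adjoint V"
proof -
  obtain v where ev: "\<And>i. i \<in> {1..n} \<Longrightarrow> eigenvector M (v i) (complex_of_real (eigval i M))"
    and on: "\<And>i j. i \<in> {1..n} \<Longrightarrow> j \<in> {1..n} \<Longrightarrow> v i \<bullet>c v j = (if i = j then 1 else 0)"
    and eq: "M = spectral_sum M v n" "Mr = spectral_sum M v r"
    using svd unfolding is_truncated_svd_def by blast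
  define V where "V = mat n n (\<lambda>(a, j). v (Suc j) $ a)"
  have V: "V \<in> carrier_mat n n" by (simp add: V_def)
  have "mat_adjoint V * V = 1\<^sub>m n"
  proof (rule eq_matI)
    fix i j assume "i < dim_row (1\<^sub>m n :: complex mat)" "j < dim_col (1\<^sub>m n :: complex mat)"
    then have ij: "i < n" "j < n" by auto
    then have "v (Suc i) \<in> carrier_vec n" using ev[of "Suc i"] M by (auto simp: eigenvector_def)
    then have "(mat_adjoint V * V) $$ (i, j) = v (Suc j) \<bullet>c v (Suc i)"
      using ij by (auto simp: V_def scalar_prod_def lessThan_atLeast0 mult.commute intro!: sum.cong)
    also have "\<dots> = 1\<^sub>m n $$ (i, j)" using on[of "Suc j" "Suc i"] ij by auto
    finally show "(mat_adjoint V * V) $$ (i, j) = 1\<^sub>m n $$ (i, j)" .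
  qed (use V in auto)
  then have "unitary n V" using V by (simp add: unitary_def)
  moreover have "M = V * rdiag n (\<lambda>i. if i < n then eigval (Suc i) M else 0) * mat_adjoint V"
    using spectral_sum_eq_unitary_conj[OF M order.refl, of v] eq(1) by (simp add: V_def)
  moreover have "rdiag n (\<lambda>i. if i < n then eigval (Suc i) M else 0) = rdiag n (\<lambda>i. eigval (Suc i) M)"
    by (rule eq_matI) (auto simp: mat_diag_def)
  moreover have "Mr = V * rdiag n (\<lambda>i. if i < r then eigval (Suc i) M else 0) * mat_adjoint V"
    using spectral_sum_eq_unitary_conj[OF M r, of v] eq(2) by (simp add: V_def)
  ultimately show ?thesis using that by simp
qed

section \<open>A scalar inequality for doubly stochastic weights\<close>

text \<open>The Itakura--Saito divergence of a positive number from 1, the case of dimension one of the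
  log determinant divergence: \<open>logdet_div X Y\<close> for positive \<open>1 \<times> 1\<close> matrices is its value at \<open>X / Y\<close>.\<close>

definition itakura_saito :: "real \<Rightarrow> real" where
  "itakura_saito x = x - 1 - ln x"

lemma itakura_saito_nonneg: "0 < x \<Longrightarrow> 0 \<le> itakura_saito x"
  using ln_le_minus_one[of x] by (simp add: itakura_saito_def)

lemma itakura_saito_1 [simp]: "itakura_saito 1 = 0"
  by (simp add: itakura_saito_def)

lemma itakura_saito_antimono:
  assumes "0 < x" "x \<le> y" "y \<le> 1"
  shows "itakura_saito y \<le> itakura_saito x"
proof -
  have "ln (y / x) \<ge> 1 - x / y"
    using ln_le_minus_one[of "x / y"] assms by (simp add: ln_div)
  moreover have "1 - x / y = (y - x) / y" using assms by (simp add: field_simps)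
  moreover have "y - x \<le> (y - x) / y" using assms by (simp add: le_divide_eq mult_left_le)
  ultimately show ?thesis using assms by (simp add: itakura_saito_def ln_div)
qed

text \<open>Weights in \<open>[0, 1]\<close> of total at least \<open>n - r\<close>, placed on nonincreasing costs \<open>g \<ge> 0\<close>, cost least when
  the last \<open>n - r\<close> positions carry weight 1. Comparing every \<open>g i\<close> with the threshold \<open>g r\<close> proves it:
  the weight placed before position \<open>r\<close> costs at least \<open>g r\<close> per unit, and the weight missing from there
  on saves at most \<open>g r\<close> per unit.\<close>

lemma sum_tail_le_weighted_sum:
  fixes g q :: "nat \<Rightarrow> real"
  assumes anti: "\<And>i j. i \<le> j \<Longrightarrow> j < n \<Longrightarrow> g j \<le> g i" and g: "\<And>i. i < n \<Longrightarrow> 0 \<le> g i"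
    and q: "\<And>i. i < n \<Longrightarrow> 0 \<le> q i" "\<And>i. i < n \<Longrightarrow> q i \<le> 1"
    and sum: "real n - real r \<le> (\<Sum>i<n. q i)" and r: "r < n"
  shows "(\<Sum>i = r..<n. g i) \<le> (\<Sum>i<n. q i * g i)"
proof -
  have split: "(\<Sum>i<n. f i) = (\<Sum>i<r. f i) + (\<Sum>i = r..<n. f i)" for f :: "nat \<Rightarrow> real"
    using r by (metis lessThan_atLeast0 le0 less_imp_le sum.atLeastLessThan_concat)
  \<comment> \<open>Excess total weight, priced at the threshold.\<close>
  have "0 \<le> ((\<Sum>i<n. q i) - (real n - real r)) * g r"
    using sum g[OF r] by simp
  also have "\<dots> = (\<Sum>i<r. q i * g r) + (\<Sum>i = r..<n. (q i - 1) * g r)"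
    using r by (simp add: split sum_subtractf sum_distrib_left algebra_simps of_nat_diff)
  also have "\<dots> \<le> (\<Sum>i<r. q i * g i) + (\<Sum>i = r..<n. (q i - 1) * g i)"
  proof (intro add_mono sum_mono)
    fix i assume "i \<in> {..<r}"
    then show "q i * g r \<le> q i * g i" using q(1)[of i] anti[of i r] r by (intro mult_left_mono) auto
  next
    fix i assume "i \<in> {r..<n}"
    then show "(q i - 1) * g r \<le> (q i - 1) * g i"
      using q(2)[of i] anti[of r i] by (intro mult_left_mono_neg) auto
  qed
  also have "\<dots> = (\<Sum>i<n. q i * g i) - (\<Sum>i = r..<n. g i)"
    by (simp add: split left_diff_distrib sum_subtractf)
  finally show ?thesis by simp
qed

text \<open>The entries \<open>a j\<close> stand for the eigenvalues of \<open>I + X\<close>, of which at most \<open>r\<close> differ from 1, and \<open>b i\<close> for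
  those of \<open>I + G\<close>. Only the columns with \<open>a j = 1\<close> are kept; the weight \<open>q i\<close> that they leave in row \<open>i\<close>
  meets the conditions of the preceding lemma.\<close>

lemma doubly_stochastic_tail_bound:
  fixes p :: "nat \<Rightarrow> nat \<Rightarrow> real" and a b :: "nat \<Rightarrow> real"
  assumes p: "\<And>i j. i < n \<Longrightarrow> j < n \<Longrightarrow> 0 \<le> p i j"
    and rows: "\<And>i. i < n \<Longrightarrow> (\<Sum>j<n. p i j) = 1" and columns: "\<And>j. j < n \<Longrightarrow> (\<Sum>i<n. p i j) = 1"
    and a: "\<And>j. j < n \<Longrightarrow> 0 < a j" and few: "card {j. j < n \<and> a j \<noteq> 1} \<le> r"
    and b: "\<And>i. i < n \<Longrightarrow> 1 \<le> b i" "\<And>i j. i \<le> j \<Longrightarrow> j < n \<Longrightarrow> b j \<le> b i" and r: "r < n"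
  shows "(\<Sum>i = r..<n. itakura_saito (1 / b i)) \<le> (\<Sum>i<n. \<Sum>j<n. p i j * itakura_saito (a j / b i))"
proof -
  let ?J = "{j. j < n \<and> a j = 1}"
  have J: "?J \<subseteq> {..<n}" by auto
  have "{..<n} = ?J \<union> {j. j < n \<and> a j \<noteq> 1}" by auto
  then have "card {..<n} = card ?J + card {j. j < n \<and> a j \<noteq> 1}"
    by (simp only:, subst card_Un_disjoint) auto
  then have card: "n \<le> card ?J + r" using few by simp
  define q where "q i = (\<Sum>j\<in>?J. p i j)" for i
  have b0: "0 < b i" if "i < n" for i using b(1)[OF that] by simp
  have "(\<Sum>i = r..<n. itakura_saito (1 / b i)) \<le> (\<Sum>i<n. q i * itakura_saito (1 / b i))"
  proof (rule sum_tail_le_weighted_sum[OF _ _ _ _ _ r])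
    show "itakura_saito (1 / b j) \<le> itakura_saito (1 / b i)" if "i \<le> j" "j < n" for i j
      using b(1)[of i] b(1)[of j] b(2)[OF that] that
      by (intro itakura_saito_antimono) (auto intro!: divide_left_mono)
    show "0 \<le> itakura_saito (1 / b i)" if "i < n" for i
      using b0[OF that] by (intro itakura_saito_nonneg) simp
    show "0 \<le> q i" if "i < n" for i using p that by (auto simp: q_def intro!: sum_nonneg)
    show "q i \<le> 1" if "i < n" for i
      unfolding q_def rows[OF that, symmetric] using J p that by (intro sum_mono2) auto
    have "(\<Sum>i<n. q i) = (\<Sum>j\<in>?J. \<Sum>i<n. p i j)" unfolding q_def by (rule sum.swap)
    also have "\<dots> = real (card ?J)" using columns by simp
    finally show "real n - real r \<le> (\<Sum>i<n. q i)" using card by linarith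
  qed
  also have "\<dots> \<le> (\<Sum>i<n. \<Sum>j<n. p i j * itakura_saito (a j / b i))"
  proof (rule sum_mono)
    fix i assume "i \<in> {..<n}"
    then have i: "i < n" by simp
    have "q i * itakura_saito (1 / b i) = (\<Sum>j\<in>?J. p i j * itakura_saito (a j / b i))"
      by (simp add: q_def sum_distrib_right)
    also have "\<dots> \<le> (\<Sum>j<n. p i j * itakura_saito (a j / b i))"
      using J p a b0 i by (intro sum_mono2) (auto intro!: mult_nonneg_nonneg itakura_saito_nonneg)
    finally show "q i * itakura_saito (1 / b i) \<le> (\<Sum>j<n. p i j * itakura_saito (a j / b i))" .
  qed
  finally show ?thesis .
qed

section \<open>The divergence as a doubly stochastic average\<close>

lemma mat_trace_mult_comm:
  assumes "A \<in> carrier_mat n n" "B \<in> carrier_mat n n"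
  shows "mat_trace (A * B) = mat_trace (B * A)"
proof -
  have "mat_trace (A * B) = (\<Sum>i<n. \<Sum>k<n. A $$ (i, k) * B $$ (k, i))"
    using assms by (auto simp: mat_trace_def scalar_prod_def lessThan_atLeast0 intro!: sum.cong)
  also have "\<dots> = (\<Sum>k<n. \<Sum>i<n. A $$ (i, k) * B $$ (k, i))" by (rule sum.swap)
  also have "\<dots> = mat_trace (B * A)"
    using assms by (auto simp: mat_trace_def scalar_prod_def lessThan_atLeast0 mult.commute intro!: sum.cong)
  finally show ?thesis .
qed

lemma mat_trace_similar:
  assumes "P \<in> carrier_mat n n" "R \<in> carrier_mat n n" "P * R = 1\<^sub>m n" "M \<in> carrier_mat n n"
  shows "mat_trace (P * M * R) = mat_trace M"
proof -
  have RP: "R * P = 1\<^sub>m n" using mat_mult_left_right_inverse[OF assms(1-3)] .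
  have "mat_trace (P * M * R) = mat_trace (R * (P * M))"
    by (rule mat_trace_mult_comm[OF _ assms(2)]) (simp add: assms square_mat_simps[where n = n])
  also have "R * (P * M) = M" by (rule mult_cancel_inverse[OF assms(2,1,4) RP])
  finally show ?thesis .
qed

lemma mat_inv_congruence:
  assumes Q: "Q \<in> carrier_mat n n" "det Q \<noteq> 0" and V: "unitary n V" and b: "\<And>i. i < n \<Longrightarrow> 0 < b i"
  shows "mat_inv (Q * (V * rdiag n b * mat_adjoint V) * mat_adjoint Q) =
    mat_adjoint (mat_inv Q) * (V * rdiag n (\<lambda>i. 1 / b i) * mat_adjoint V) * mat_inv Q"
    (is "mat_inv ?S = ?T")
proof (rule mat_inv_eqI)
  note Qi = mat_inv_of_det[OF Q]
  note Vc = unitaryD[OF V]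
  have adj: "mat_adjoint Q \<in> carrier_mat n n" "mat_adjoint (mat_inv Q) \<in> carrier_mat n n"
    using Q Qi by (simp_all add: mat_adjoint_carrier)
  note sq = square_mat_simps[where n = n]
  have QQ: "mat_adjoint Q * mat_adjoint (mat_inv Q) = 1\<^sub>m n"
    using sq(3)[OF Qi(1) Q(1)] Qi(3) by simp
  have bb: "rdiag n b * rdiag n (\<lambda>i. 1 / b i) = 1\<^sub>m n"
    unfolding mat_diag_diag by (rule eq_matI) (use b in \<open>force simp: mat_diag_def\<close>)+
  show "?S \<in> carrier_mat n n" "?T \<in> carrier_mat n n"
    using Q Qi Vc adj by (simp_all add: sq)
  have "?S * ?T = Q * (V * (rdiag n b * (mat_adjoint V * (mat_adjoint Q * (mat_adjoint (mat_inv Q) *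
      (V * (rdiag n (\<lambda>i. 1 / b i) * (mat_adjoint V * mat_inv Q))))))))"
    using Q Qi(1) Vc(1,2) adj by (simp add: sq del: mat_diag_diag)
  also have "\<dots> = 1\<^sub>m n"
    using Q Qi Vc adj QQ bb by (simp add: sq mult_cancel_inverse[where n = n] del: mat_diag_diag)
  finally show "?S * ?T = 1\<^sub>m n" .
qed

text \<open>With \<open>U = V\<^sup>* W\<close> the matrix \<open>P S\<^sup>-\<^sup>1\<close> is similar to \<open>U diag(a) U\<^sup>* diag(b)\<^sup>-\<^sup>1\<close>. Its trace is the sum of the
  \<open>p\<^sub>i\<^sub>j a\<^sub>j / b\<^sub>i\<close> and its determinant is the product of the \<open>a\<^sub>j\<close> divided by that of the \<open>b\<^sub>i\<close>. As
  rows and columns of \<open>p\<close> sum to 1, the logarithm of the determinant and the constant \<open>n\<close> can be spread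
  over the same double sum.\<close>

lemma logdet_div_congruence:
  assumes Q: "Q \<in> carrier_mat n n" "det Q \<noteq> 0" and W: "unitary n W" and V: "unitary n V"
    and a: "\<And>i. i < n \<Longrightarrow> 0 < a i" and b: "\<And>i. i < n \<Longrightarrow> 0 < b i"
  shows "logdet_div (Q * (W * rdiag n a * mat_adjoint W) * mat_adjoint Q)
      (Q * (V * rdiag n b * mat_adjoint V) * mat_adjoint Q) =
    (\<Sum>i<n. \<Sum>j<n. (cmod ((mat_adjoint V * W) $$ (i, j)))\<^sup>2 * itakura_saito (a j / b i))"
    (is "logdet_div ?P ?S = _")
proof -
  note Qi = mat_inv_of_det[OF Q]
  note Vc = unitaryD[OF V]
  note Wc = unitaryD[OF W]
  have adj: "mat_adjoint Q \<in> carrier_mat n n" "mat_adjoint (mat_inv Q) \<in> carrier_mat n n"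
    using Q Qi by (simp_all add: mat_adjoint_carrier)
  note sq = square_mat_simps[where n = n]
  have QQ: "mat_adjoint Q * mat_adjoint (mat_inv Q) = 1\<^sub>m n"
    using sq(3)[OF Qi(1) Q(1)] Qi(3) by simp
  define U where "U = mat_adjoint V * W"
  have U: "unitary n U" unfolding U_def by (rule unitary_mult[OF unitary_adjoint[OF V] W])
  note Uc = unitaryD[OF U]
  define p where "p i j = (cmod (U $$ (i, j)))\<^sup>2" for i j
  have rows: "(\<Sum>j<n. p i j) = 1" if "i < n" for i unfolding p_def by (rule unitary_row_sum[OF U that])
  have columns: "(\<Sum>i<n. p i j) = 1" if "j < n" for j unfolding p_def by (rule unitary_column_sum[OF U that])
  define M where "M = U * rdiag n a * (mat_adjoint U * rdiag n (\<lambda>i. 1 / b i))"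
  have M: "M \<in> carrier_mat n n" using Uc by (simp add: M_def sq)
  have K: "Q * V \<in> carrier_mat n n" "mat_adjoint V * mat_inv Q \<in> carrier_mat n n"
    using Q Qi Vc by (simp_all add: sq)
  have KK: "(Q * V) * (mat_adjoint V * mat_inv Q) = 1\<^sub>m n"
    using Q Qi Vc by (simp add: sq mult_cancel_inverse[where n = n])
  have inv: "mat_inv ?S =
      mat_adjoint (mat_inv Q) * (V * rdiag n (\<lambda>i. 1 / b i) * mat_adjoint V) * mat_inv Q"
    using mat_inv_congruence[OF Q V] b .
  have eq: "?P * mat_inv ?S = (Q * V) * M * (mat_adjoint V * mat_inv Q)"
    unfolding inv M_def U_def
    using Q Qi Vc Wc adj QQ by (simp add: sq mult_cancel_inverse[where n = n] del: mat_diag_diag)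
  have dimP: "dim_row ?P = n" using Q by simp
  have "mat_trace M = (\<Sum>i<n. \<Sum>j<n. complex_of_real (p i j * (a j / b i)))"
  proof -
    have M': "M $$ (i, i) = (\<Sum>j<n. complex_of_real (p i j * (a j / b i)))" if "i < n" for i
      unfolding M_def mat_diag_mult_right[OF Uc(1)] mat_diag_mult_right[OF Uc(2)] p_def
      using that Uc(1)
      by (auto simp: scalar_prod_def lessThan_atLeast0 complex_norm_square[simplified] intro!: sum.cong)
    then show ?thesis using M by (simp add: mat_trace_def)
  qed
  then have trace: "Re (mat_trace (?P * mat_inv ?S)) = (\<Sum>i<n. \<Sum>j<n. p i j * (a j / b i))"
    unfolding eq mat_trace_similar[OF K KK M] by simp
  have det_diag: "det (rdiag n d) = complex_of_real (\<Prod>i<n. d i)" for d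
    by (subst det_upper_triangular[of _ n])
       (auto simp: mat_diag_def diag_mat_def prod.list_conv_set_nth lessThan_atLeast0)
  have detU: "det U * det (mat_adjoint U) = 1"
    using det_mult[OF Uc(1,2)] Uc(4) by simp
  have "det M = (det U * det (mat_adjoint U)) * (det (rdiag n a) * det (rdiag n (\<lambda>i. 1 / b i)))"
    unfolding M_def using Uc by (simp add: det_mult[of _ n] sq)
  then have "det M = complex_of_real ((\<Prod>i<n. a i) * (\<Prod>i<n. 1 / b i))"
    unfolding det_diag detU by simp
  then have det: "Re (det (?P * mat_inv ?S)) = (\<Prod>i<n. a i) * (\<Prod>i<n. 1 / b i)"
    unfolding eq det_similar[OF mult_eq_1_similar[OF K KK M]] by (simp only: Re_complex_of_real)
  have a0: "a i \<noteq> 0" and b0: "b i \<noteq> 0" if "i < n" for i using a[OF that] b[OF that] by auto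
  have "ln ((\<Prod>i<n. a i) * (\<Prod>i<n. 1 / b i)) = (\<Sum>j<n. ln (a j)) - (\<Sum>i<n. ln (b i))"
  proof -
    have "0 < (\<Prod>i<n. a i)" "0 < (\<Prod>i<n. 1 / b i)" using a b by (auto intro!: prod_pos)
    moreover have "ln (\<Prod>i<n. a i) = (\<Sum>i<n. ln (a i))" by (rule ln_prod) (use a0 in auto)
    moreover have "ln (\<Prod>i<n. 1 / b i) = (\<Sum>i<n. ln (1 / b i))" by (rule ln_prod) (use b0 in auto)
    moreover have "(\<Sum>i<n. ln (1 / b i)) = (\<Sum>i<n. - ln (b i))"
      using b0 by (intro sum.cong) (auto simp: ln_div)
    ultimately show ?thesis by (simp add: ln_mult_pos sum_negf)
  qed
  also have "(\<Sum>j<n. ln (a j)) = (\<Sum>j<n. \<Sum>i<n. p i j * ln (a j))"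
    using columns by (simp add: sum_distrib_right[symmetric])
  also have "\<dots> = (\<Sum>i<n. \<Sum>j<n. p i j * ln (a j))" by (rule sum.swap)
  also have "(\<Sum>i<n. ln (b i)) = (\<Sum>i<n. \<Sum>j<n. p i j * ln (b i))"
    using rows by (simp add: sum_distrib_right[symmetric])
  finally have ln: "ln ((\<Prod>i<n. a i) * (\<Prod>i<n. 1 / b i)) =
      (\<Sum>i<n. \<Sum>j<n. p i j * ln (a j / b i))"
    using a0 b0 by (simp add: sum_subtractf[symmetric] right_diff_distrib[symmetric] ln_div)
  have "real n = (\<Sum>i<n. \<Sum>j<n. p i j)" using rows by simp
  then show ?thesis
    unfolding logdet_div_def trace det ln dimP itakura_saito_def U_def[symmetric] p_def[symmetric]
    by (simp add: sum_subtractf right_diff_distrib)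
qed

section \<open>Optimality of the truncation and the preconditioned spectrum\<close>

text \<open>The truncation shares the eigenvectors of \<open>G\<close>, so its weights are those of the identity matrix and the
  divergence collapses to the sum of \<open>\<phi>(1 / (1 + l i))\<close> over \<open>i \<ge> r\<close>. That is the lower bound
  which \<open>doubly_stochastic_tail_bound\<close> gives for every competitor of rank at most \<open>r\<close>.\<close>

theorem logdet_div_truncation_optimal:
  fixes l :: "nat \<Rightarrow> real"
  assumes Q: "Q \<in> carrier_mat n n" "det Q \<noteq> 0" and V: "unitary n V"
    and nn: "\<And>i. i < n \<Longrightarrow> 0 \<le> l i" and anti: "\<And>i j. i \<le> j \<Longrightarrow> j < n \<Longrightarrow> l j \<le> l i"
    and r: "r < n" and X: "hpsd n X" and rank: "vec_space.rank n X \<le> r"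
  defines "S \<equiv> Q * (1\<^sub>m n + V * rdiag n l * mat_adjoint V) * mat_adjoint Q"
  shows "logdet_div (Q * (1\<^sub>m n + V * rdiag n (\<lambda>i. if i < r then l i else 0) * mat_adjoint V) * mat_adjoint Q) S
    \<le> logdet_div (Q * (1\<^sub>m n + X) * mat_adjoint Q) S"
proof -
  obtain W m where W: "unitary n W" and Xm: "X = W * rdiag n m * mat_adjoint W"
    using hermitian_unitary_diagonalization[of X n] X by (auto simp: hpsd_def)
  have m: "0 \<le> m i" if "i < n" for i using hpsd_unitary_conj_nonneg[OF W _ that] X Xm by simp
  have few: "card {j. j < n \<and> 1 + m j \<noteq> 1} \<le> r" using rank unfolding Xm rank_unitary_conj[OF W] by simp
  define p where "p i j = (cmod ((mat_adjoint V * W) $$ (i, j)))\<^sup>2" for i j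
  have U: "unitary n (mat_adjoint V * W)" by (rule unitary_mult[OF unitary_adjoint[OF V] W])
  let ?a = "\<lambda>i. 1 + (if i < r then l i else 0)"
  have pos: "0 < 1 + l i" "0 < 1 + m i" "0 < ?a i" if "i < n" for i
    using nn[OF that] m[OF that] by auto
  have "logdet_div (Q * (1\<^sub>m n + V * rdiag n (\<lambda>i. if i < r then l i else 0) * mat_adjoint V) * mat_adjoint Q) S =
      (\<Sum>i<n. \<Sum>j<n. (cmod ((mat_adjoint V * V) $$ (i, j)))\<^sup>2 * itakura_saito (?a j / (1 + l i)))"
    unfolding S_def one_add_unitary_conj[OF V]
    by (rule logdet_div_congruence[OF Q V V]) (use pos in auto)
  also have "\<dots> = (\<Sum>i<n. itakura_saito (?a i / (1 + l i)))"
  proof (rule sum.cong[OF refl])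
    fix i assume "i \<in> {..<n}"
    then have i: "i < n" by simp
    have "(\<Sum>j<n. (cmod ((mat_adjoint V * V) $$ (i, j)))\<^sup>2 * itakura_saito (?a j / (1 + l i))) =
        (\<Sum>j<n. if j = i then itakura_saito (?a j / (1 + l i)) else 0)"
      using unitaryD(3)[OF V] i by (intro sum.cong) auto
    then show "(\<Sum>j<n. (cmod ((mat_adjoint V * V) $$ (i, j)))\<^sup>2 * itakura_saito (?a j / (1 + l i))) =
        itakura_saito (?a i / (1 + l i))" using i by simp
  qed
  also have "\<dots> = (\<Sum>i = r..<n. itakura_saito (?a i / (1 + l i)))"
  proof (rule sum.mono_neutral_right)
    show "\<forall>i\<in>{..<n} - {r..<n}. itakura_saito (?a i / (1 + l i)) = 0"
    proof
      fix i assume "i \<in> {..<n} - {r..<n}"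
      then have "i < n" "i < r" by auto
      then show "itakura_saito (?a i / (1 + l i)) = 0" using pos(1)[of i] by simp
    qed
  qed auto
  also have "\<dots> = (\<Sum>i = r..<n. itakura_saito (1 / (1 + l i)))" by (rule sum.cong) auto
  also have "\<dots> \<le> (\<Sum>i<n. \<Sum>j<n. p i j * itakura_saito ((1 + m j) / (1 + l i)))"
    by (rule doubly_stochastic_tail_bound[OF _ _ _ _ few _ _ r])
       (use unitary_row_sum[OF U] unitary_column_sum[OF U] pos nn anti in \<open>auto simp: p_def\<close>)
  also have "\<dots> = logdet_div (Q * (1\<^sub>m n + X) * mat_adjoint Q) S"
    unfolding S_def Xm one_add_unitary_conj[OF V] one_add_unitary_conj[OF W] p_def
    by (rule logdet_div_congruence[OF Q W V, symmetric]) (use pos in auto)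
  finally show ?thesis .
qed

text \<open>The inner factors \<open>Q\<^sup>-\<^sup>1 Q\<close> and \<open>V\<^sup>* V\<close> cancel, which leaves a conjugation by \<open>Q\<^sup>-\<^sup>* V\<close>.\<close>

lemma similar_mat_inv_mult_congruence:
  assumes Q: "Q \<in> carrier_mat n n" "det Q \<noteq> 0" and V: "unitary n V"
    and a: "\<And>i. i < n \<Longrightarrow> 0 < a i" and t: "\<And>i. i < n \<Longrightarrow> t i = b i / a i"
  shows "similar_mat (mat_inv (Q * (V * rdiag n a * mat_adjoint V) * mat_adjoint Q) *
      (Q * (V * rdiag n b * mat_adjoint V) * mat_adjoint Q)) (rdiag n t)"
    (is "similar_mat (mat_inv ?A * ?B) _")
proof -
  note Qi = mat_inv_of_det[OF Q]
  note Vc = unitaryD[OF V]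
  note sq = square_mat_simps[where n = n]
  have adj: "mat_adjoint Q \<in> carrier_mat n n" "mat_adjoint (mat_inv Q) \<in> carrier_mat n n"
    using Q Qi by (simp_all add: mat_adjoint_carrier)
  have QQ: "mat_adjoint (mat_inv Q) * mat_adjoint Q = 1\<^sub>m n"
    using sq(3)[OF Q(1) Qi(1)] Qi(2) by simp
  have inv: "mat_inv ?A =
      mat_adjoint (mat_inv Q) * (V * rdiag n (\<lambda>i. 1 / a i) * mat_adjoint V) * mat_inv Q"
    using mat_inv_congruence[OF Q V] a .
  have tb: "rdiag n t = rdiag n (\<lambda>i. 1 / a i) * rdiag n b"
    unfolding mat_diag_diag by (rule eq_matI) (auto simp: mat_diag_def t)
  have "mat_inv ?A * ?B =
      (mat_adjoint (mat_inv Q) * V) * rdiag n t * (mat_adjoint V * mat_adjoint Q)"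
    unfolding inv tb using Q Qi Vc adj
    by (simp add: sq mult_cancel_inverse[where n = n] del: mat_diag_diag)
  moreover have "(mat_adjoint (mat_inv Q) * V) * (mat_adjoint V * mat_adjoint Q) = 1\<^sub>m n"
    using Vc adj QQ by (simp add: sq mult_cancel_inverse[where n = n])
  ultimately show ?thesis
    using mult_eq_1_similar[of "mat_adjoint (mat_inv Q) * V" n "mat_adjoint V * mat_adjoint Q" "rdiag n t"]
      Vc adj by (simp add: sq)
qed

theorem theorem1:
  fixes n r :: nat
    and A B S Q G Gr Shat :: "complex mat"
  assumes "Q \<in> carrier_mat n n"
    and "A = Q * mat_adjoint Q" and "hpd n A"
    and "hpsd n B"
    and "S = A + B"
    and "G = mat_inv Q * B * mat_adjoint (mat_inv Q)"
    and "0 < r" and "r < vec_space.rank n B"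
    and "is_truncated_svd n r G Gr"
    and "Shat = Q * (1\<^sub>m n + Gr) * mat_adjoint Q"
  shows "is_arg_min (\<lambda>(X, P). logdet_div P S)
           (\<lambda>(X, P). hpsd n X \<and> P = Q * (1\<^sub>m n + X) * mat_adjoint Q \<and> vec_space.rank n X \<le> r)
           (Gr, Shat)
         \<and> (\<forall>z. eigenvalue (mat_inv Shat * S) z \<longrightarrow> z \<in> \<real>)
         \<and> (\<forall>i \<in> {1..vec_space.rank n B - r}. eigval i (mat_inv Shat * S) = 1 + eigval (r + i) G)
         \<and> (\<forall>i \<in> {vec_space.rank n B - r<..n}. eigval i (mat_inv Shat * S) = 1)
         \<and> count (proots (char_poly (mat_inv Shat * S))) 1 = n + r - vec_space.rank n B"
proof -
  note Qc = assms(1)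
  note sq = square_mat_simps[where n = n]
  have Qa: "mat_adjoint Q \<in> carrier_mat n n" using Qc by (rule mat_adjoint_carrier)
  have "det Q * det (mat_adjoint Q) \<noteq> 0"
    using hpd_imp_det_nonzero[OF assms(3)] det_mult[OF Qc Qa] assms(2) by simp
  then have detQ: "det Q \<noteq> 0" by simp
  note Qi = mat_inv_of_det[OF Qc detQ]
  have Qia: "mat_adjoint (mat_inv Q) \<in> carrier_mat n n" using Qi(1) by (rule mat_adjoint_carrier)
  have QQ: "mat_adjoint (mat_inv Q) * mat_adjoint Q = 1\<^sub>m n"
    using sq(3)[OF Qc Qi(1)] Qi(2) by simp
  have Bc: "B \<in> carrier_mat n n" using assms(4) by (simp add: hpsd_def)
  have Gps: "hpsd n G" unfolding assms(6) by (rule hpsd_congruence[OF assms(4) Qi(1)])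
  have Gc: "G \<in> carrier_mat n n" using Gps by (simp add: hpsd_def)
  have BG: "B = Q * G * mat_adjoint Q"
    using Qc Qa Qi Qia Bc QQ by (simp add: assms(6) sq mult_cancel_inverse[where n = n])
  have Rn: "vec_space.rank n B \<le> n" by (rule vec_space.rank_le_nc[OF Bc])
  define R where "R = vec_space.rank n B"
  have rR: "r < R" and Rn: "R \<le> n" and rn: "r < n" using assms(8) Rn by (auto simp: R_def)
  define l where "l = (\<lambda>i. eigval (Suc i) G)"
  define lr where "lr = (\<lambda>i. if i < r then l i else 0)"
  obtain V where V: "unitary n V" and G: "G = V * rdiag n l * mat_adjoint V"
    and Gr: "Gr = V * rdiag n lr * mat_adjoint V"
    unfolding lr_def l_def by (rule truncated_svd_unitary[OF Gc less_imp_le[OF rn] assms(9)])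
  have nn: "0 \<le> l i" if "i < n" for i
    using hpsd_unitary_conj_nonneg[OF V _ that] Gps G by simp
  have anti: "l j \<le> l i" if "i \<le> j" "j < n" for i j
    unfolding l_def by (rule eigval_antimono[OF Gc that])
  have "R = card {i. i < n \<and> l i \<noteq> 0}"
    unfolding R_def BG G by (rule rank_congruence_unitary_conj[OF Qc detQ V])
  then have supp: "l i \<noteq> 0 \<longleftrightarrow> i < R" if "i < n" for i
    using antimono_support_initial[of n l, OF nn anti that] by simp
  have "S = Q * 1\<^sub>m n * mat_adjoint Q + Q * G * mat_adjoint Q"
    using Qc by (simp add: assms(2,5) BG[symmetric])
  also have "\<dots> = Q * (1\<^sub>m n + G) * mat_adjoint Q"
    using Qc Qa Gc by (simp add: mult_add_distrib_mat[of _ n n _ n] add_mult_distrib_mat[of _ n n _ _ n] sq)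
  finally have S: "S = Q * (1\<^sub>m n + G) * mat_adjoint Q" .

  have "{i. i < n \<and> lr i \<noteq> 0} \<subseteq> {..<r}" by (auto simp: lr_def)
  then have "vec_space.rank n Gr \<le> r"
    unfolding Gr rank_unitary_conj[OF V] using card_mono[of "{..<r}"] by fastforce
  moreover have "hpsd n Gr"
    unfolding Gr by (rule unitary_conj_hpsd[OF V]) (simp add: lr_def nn)
  moreover have "logdet_div Shat S \<le> logdet_div (Q * (1\<^sub>m n + X) * mat_adjoint Q) S"
    if "hpsd n X" "vec_space.rank n X \<le> r" for X
    using logdet_div_truncation_optimal[OF Qc detQ V nn anti rn that]
    unfolding assms(10) S Gr G lr_def by simp
  ultimately have min: "is_arg_min (\<lambda>(X, P). logdet_div P S)
      (\<lambda>(X, P). hpsd n X \<and> P = Q * (1\<^sub>m n + X) * mat_adjoint Q \<and> vec_space.rank n X \<le> r) (Gr, Shat)"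
    unfolding is_arg_min_linorder using assms(10) by auto

  \<comment> \<open>The spectrum of the preconditioned matrix, in the order of the eigenvectors (\<open>t\<close>) and sorted (\<open>s\<close>).\<close>
  define t where "t i = (if i < r then 1 else 1 + l i)" for i
  define s where "s i = (if i < n - r then 1 + l (i + r) else 1)" for i
  define M where "M = mat_inv Shat * S"
  have sim: "similar_mat M (rdiag n t)"
    unfolding M_def assms(10) S Gr G one_add_unitary_conj[OF V]
  proof (rule similar_mat_inv_mult_congruence[OF Qc detQ V])
    fix i assume "i < n"
    then show "0 < 1 + lr i" "t i = (1 + l i) / (1 + lr i)" using nn[of i] by (auto simp: lr_def t_def)
  qed
  have "mset (map s [0..<n]) = mset (map t [0..<n])"
    unfolding s_def t_def by (rule mset_shifted_range) (use rn in simp)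
  moreover have "s j \<le> s i" if "i \<le> j" "j < n" for i j
    using that anti[of "i + r" "j + r"] nn[of "i + r"] by (auto simp: s_def)
  ultimately have eigs: "ordered_eigvals M = map s [0..<n]"
    by (rule ordered_eigvals_similar_rdiag_eqI[OF sim])
  have eig: "eigval i M = s (i - 1)" if "1 \<le> i" "i \<le> n" for i
    using that by (simp add: eigval_def eigs)
  have 1: "eigval i M = 1 + eigval (r + i) G" if "i \<in> {1..R - r}" for i
    using that Rn rR eig[of i] by (auto simp: s_def l_def add.commute)
  \<comment> \<open>Up to index \<open>n - r\<close> the value 1 comes from the kernel of \<open>G\<close>, after it from the \<open>r\<close> retained eigenvectors.\<close>
  have 2: "eigval i M = 1" if "i \<in> {R - r<..n}" for i
  proof (cases "i - 1 < n - r")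
    case True
    then have "i - 1 + r < n" "\<not> i - 1 + r < R" using that rR by auto
    then show ?thesis using supp[of "i - 1 + r"] eig[of i] that True by (simp add: s_def)
  next
    case False
    then show ?thesis using eig[of i] that by (auto simp: s_def)
  qed
  have roots: "proots (char_poly M) = image_mset (\<lambda>i. complex_of_real (t i)) (mset [0..<n])"
    by (rule proots_char_poly_similar_rdiag[OF sim])
  obtain m P K where "{M, rdiag n t, P, K} \<subseteq> carrier_mat m m"
    using similar_matD[OF sim] by metis
  then have "M \<in> carrier_mat m m" "rdiag n t \<in> carrier_mat m m" by (simp_all only: insert_subset)
  then have Mc: "M \<in> carrier_mat n n"
    using carrier_matD(1)[of "rdiag n t" m m] carrier_matD(1)[OF mat_diag_dim, of n] by metis
  have "z \<in> \<real>" if "eigenvalue M z" for z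
  proof -
    have "char_poly M \<noteq> 0" using degree_monic_char_poly[OF Mc] by auto
    then have "z \<in># proots (char_poly M)"
      using that eigenvalue_root_char_poly[OF Mc] by simp
    then show ?thesis unfolding roots by auto
  qed
  moreover have "count (proots (char_poly M)) 1 = n + r - R"
  proof -
    have "count (proots (char_poly M)) 1 = card {i. i < n \<and> t i = 1}"
      unfolding roots count_image_mset
      by (auto simp: vimage_def Int_def intro!: arg_cong[where f = card])
    also have "{i. i < n \<and> t i = 1} = {..<n} - {r..<R}"
    proof -
      have "l i = 0 \<longleftrightarrow> R \<le> i" if "i < n" for i using supp[OF that] by auto
      then show ?thesis by (auto simp: t_def)
    qed
    also have "card \<dots> = n - (R - r)" using Rn by (subst card_Diff_subset) auto
    finally show ?thesis using rR Rn by simp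
  qed
  ultimately show ?thesis
    using min 1 2 unfolding M_def R_def by blast
qed

end
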